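(* Let $\lambda=(m,n)$ be a triangular $2$-partition and $\theta$ a standard Young tableau of shape $\lambda$. If $n\neq 2$, then $\theta$ is a sim-sym tableau if and only if it is a row-regular tableau. If $n=2$, then $\theta$ is a sim-sym tableau if and only if $\theta$ is a row-regular tableau or the labels on the upper row of $\theta$ are $2$ and $5$.
   Context: Partitions are drawn in French convention: cell $(\ell,c)$ ($\ell\ge0$ row from bottom, $c\ge0$ column) belongs to $\lambda$ iff $c<\lambda_{\ell+1}$. A $2$-partition $(m,n)$ has $m\ge n\ge0$. A partition is triangular if there are positive reals $r,s$ with $\lambda_j=\lfloor r-jr/s\rfloor$ for $1\le j\le s$ and $\lambda_j=0$ for $j>s$. For a cell $c$ of a partition $\mu$, the arm $a(c)$ (resp. leg $\ell(c)$) is the number of cells of $\mu$ strictly to the right of $c$ in its row (resp. strictly above $c$ in its column); $v^-(c,\mu)=\ell(c)/(a(c)+\ell(c)+1)$, $v^+(c,\mu)=(\ell(c)+1)/(a(c)+\ell(c)+1)$; $v^-_\lambda=\max_{c\in\lambda}v^-(c,\lambda)$, $v^+_\lambda=\min_{c\in\lambda}v^+(c,\lambda)$. For a subpartition $\mu\subseteq\lambda$, a cell $c$ of $\mu$ is similar if $v^-(c,\mu)<\frac{v^-_\lambda+v^+_\lambda}{2}\le v^+(c,\mu)$; $\mathrm{sim}(\lambda,\mu)$ is the number of similar cells, $\mathrm{area}(\lambda,\mu)=|\lambda|-|\mu|$, and $A_\lambda(q,t)=\sum_{\mu\subseteq\lambda}q^{\mathrm{area}(\lambda,\mu)}t^{\mathrm{sim}(\lambda,\mu)}$.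 For a standard Young tableau $\theta$ of shape $\lambda$, a cell $d$ is a $\theta$-deficit cell of $(\lambda,\mu)$ if there exist $c_1=(i_1,j_1)\in\mu$, $c_2=(i_2,j_2)\in\lambda\setminus\mu$ with $\theta(c_1)>\theta(c_2)$ and $d=(\min(i_1,i_2),\min(j_1,j_2))$; $\mathrm{sim}_\theta(\mu)$ is the number of cells of $\mu$ that are not $\theta$-deficit cells, and $A_\theta(q,t)=\sum_{\mu\subseteq\lambda}q^{\mathrm{area}(\lambda,\mu)}t^{\mathrm{sim}_\theta(\mu)}$. $\theta$ is sim-sym if $A_\theta(q,t)=A_\lambda(q,t)$. For $1\le i\le m-2(n-1)$, the $i$-row-regular tableau of $(m,n)$ is the standard Young tableau whose upper-row labels are $n+i,n+i+2,\dots,n+i+2(n-1)$; row-regular means $i$-row-regular for some such $i$. *)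

theory Defs
  imports Complex_Main "HOL-Computational_Algebra.Polynomial"
begin

(* A partition is the function of its row lengths, indexed from 0 (bottom row, French
   convention): p l is the part usually written p_(l+1), and a cell is a pair (row, column). *)

type_synonym partition = "nat \<Rightarrow> nat"
type_synonym cell = "nat \<times> nat"
type_synonym tableau = "cell \<Rightarrow> nat"

definition is_partition :: "partition \<Rightarrow> bool" where
  "is_partition p \<longleftrightarrow> antimono p \<and> finite {l. p l \<noteq> 0}"

definition cells :: "partition \<Rightarrow> cell set" where
  "cells p = {(l, c). c < p l}"

definition two_partition :: "nat \<Rightarrow> nat \<Rightarrow> partition" where
  "two_partition m n = (\<lambda>l. if l = 0 then m else if l = 1 then n else 0)"

definition triangular :: "partition \<Rightarrow> bool" where
  "triangular p \<longleftrightarrow> (\<exists>r s :: real. r > 0 \<and> s > 0 \<and>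
     (\<forall>j\<ge>1. (real j \<le> s \<longrightarrow> int (p (j - 1)) = \<lfloor>r - real j * r / s\<rfloor>) \<and>
            (real j > s \<longrightarrow> p (j - 1) = 0)))"

definition subpartitions :: "partition \<Rightarrow> partition set" where
  "subpartitions p = {u. is_partition u \<and> cells u \<subseteq> cells p}"

definition arm :: "cell \<Rightarrow> partition \<Rightarrow> nat" where
  "arm d p = card {c'. snd d < c' \<and> (fst d, c') \<in> cells p}"

definition leg :: "cell \<Rightarrow> partition \<Rightarrow> nat" where
  "leg d p = card {l'. fst d < l' \<and> (l', snd d) \<in> cells p}"

definition v_minus :: "cell \<Rightarrow> partition \<Rightarrow> real" where
  "v_minus d p = real (leg d p) / real (arm d p + leg d p + 1)"

definition v_plus :: "cell \<Rightarrow> partition \<Rightarrow> real" where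
  "v_plus d p = real (leg d p + 1) / real (arm d p + leg d p + 1)"

(* For the empty partition the two extrema below are unspecified; this is harmless, since
   they are only ever compared with slopes at cells of subpartitions. *)

definition max_v_minus :: "partition \<Rightarrow> real" where
  "max_v_minus p = Max ((\<lambda>d. v_minus d p) ` cells p)"

definition min_v_plus :: "partition \<Rightarrow> real" where
  "min_v_plus p = Min ((\<lambda>d. v_plus d p) ` cells p)"

definition similar_cell :: "partition \<Rightarrow> partition \<Rightarrow> cell \<Rightarrow> bool" where
  "similar_cell p u d \<longleftrightarrow> d \<in> cells u \<and>
     v_minus d u < (max_v_minus p + min_v_plus p) / 2 \<and>
     (max_v_minus p + min_v_plus p) / 2 \<le> v_plus d u"

definition sim :: "partition \<Rightarrow> partition \<Rightarrow> nat" where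
  "sim p u = card {d. similar_cell p u d}"

definition area :: "partition \<Rightarrow> partition \<Rightarrow> nat" where
  "area p u = card (cells p) - card (cells u)"

(* q^a t^b in Z[t][q]: the outer polynomial variable is q, the inner one is t. *)
definition qt_monom :: "nat \<Rightarrow> nat \<Rightarrow> int poly poly" where
  "qt_monom a b = monom (monom 1 b) a"

definition A_partition :: "partition \<Rightarrow> int poly poly" where
  "A_partition p = (\<Sum>u\<in>subpartitions p. qt_monom (area p u) (sim p u))"

definition standard_young_tableau :: "partition \<Rightarrow> tableau \<Rightarrow> bool" where
  "standard_young_tableau p \<theta> \<longleftrightarrow>
     bij_betw \<theta> (cells p) {1..card (cells p)} \<and>
     (\<forall>l c c'. (l, c) \<in> cells p \<and> (l, c') \<in> cells p \<and> c < c' \<longrightarrow> \<theta> (l, c) < \<theta> (l, c')) \<and>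
     (\<forall>l l' c. (l, c) \<in> cells p \<and> (l', c) \<in> cells p \<and> l < l' \<longrightarrow> \<theta> (l, c) < \<theta> (l', c))"

definition deficit_cell :: "partition \<Rightarrow> tableau \<Rightarrow> partition \<Rightarrow> cell \<Rightarrow> bool" where
  "deficit_cell p \<theta> u d \<longleftrightarrow>
     (\<exists>i\<^sub>1 j\<^sub>1 i\<^sub>2 j\<^sub>2. (i\<^sub>1, j\<^sub>1) \<in> cells u \<and> (i\<^sub>2, j\<^sub>2) \<in> cells p - cells u \<and>
        \<theta> (i\<^sub>1, j\<^sub>1) > \<theta> (i\<^sub>2, j\<^sub>2) \<and> d = (min i\<^sub>1 i\<^sub>2, min j\<^sub>1 j\<^sub>2))"

definition sim_tableau :: "partition \<Rightarrow> tableau \<Rightarrow> partition \<Rightarrow> nat" where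
  "sim_tableau p \<theta> u = card {d \<in> cells u. \<not> deficit_cell p \<theta> u d}"

definition A_tableau :: "partition \<Rightarrow> tableau \<Rightarrow> int poly poly" where
  "A_tableau p \<theta> = (\<Sum>u\<in>subpartitions p. qt_monom (area p u) (sim_tableau p \<theta> u))"

definition sim_sym :: "partition \<Rightarrow> tableau \<Rightarrow> bool" where
  "sim_sym p \<theta> \<longleftrightarrow> A_tableau p \<theta> = A_partition p"

definition upper_row :: "nat \<Rightarrow> tableau \<Rightarrow> nat list" where
  "upper_row n \<theta> = map (\<lambda>c. \<theta> (1, c)) [0..<n]"

definition i_row_regular :: "nat \<Rightarrow> nat \<Rightarrow> nat \<Rightarrow> tableau \<Rightarrow> bool" where
  "i_row_regular i m n \<theta> \<longleftrightarrow> standard_young_tableau (two_partition m n) \<theta> \<and>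
     upper_row n \<theta> = map (\<lambda>k. n + i + 2 * k) [0..<n]"

(* The upper bound on i is taken in int because n - 1 is negative for n = 0. *)
definition row_regular :: "nat \<Rightarrow> nat \<Rightarrow> tableau \<Rightarrow> bool" where
  "row_regular m n \<theta> \<longleftrightarrow>
     (\<exists>i\<ge>1. int i \<le> int m - 2 * (int n - 1) \<and> i_row_regular i m n \<theta>)"

end

theory Submission
  imports Defs
begin

text \<open>
  A subpartition of \<open>(m, n)\<close> is a pair \<open>(a, b)\<close>. For a tableau let \<open>g k\<close> be the number of lower
  labels below the \<open>k\<close>-th upper label, so that this label is \<open>g k + k + 1\<close>. The deficit cells of
  \<open>(a, b)\<close> lie in the bottom row, in the columns \<open>k < b\<close> with \<open>a < g k\<close> and \<open>b \<le> k < n\<close> with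
  \<open>g k < a\<close>; the cells that are not similar have the same description with \<open>g k = F + k\<close>, where \<open>F\<close>
  is the integral part of the inverse of the mean slope. Triangularity means \<open>2 n \<le> m + 1\<close> and
  yields \<open>n \<le> F \<le> m - n + 1\<close>. For every such consecutive \<open>g\<close> and every size \<open>N\<close> the deficit
  numbers of the pairs with \<open>a + b = N\<close> are exactly \<open>0, 1, 2, \<dots>\<close>, each occurring once, so a
  tableau is sim-sym iff it has this property too. Looking at a few well chosen sizes \<open>N\<close> shows
  that the property forces \<open>g\<close> to increase by steps of one from a value at least \<open>n\<close>, except that
  \<open>g = (1, 3)\<close> survives for \<open>n = 2\<close>.
\<close>

section \<open>Deficit numbers and balance\<close>

definition pairs :: "nat \<Rightarrow> nat \<Rightarrow> (nat \<times> nat) set" where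
  "pairs m n = {(a, b). b \<le> a \<and> a \<le> m \<and> b \<le> n}"

text \<open>In the first set the upper cell is inside although a lower cell with a smaller label is
  missing; in the second it is missing although a lower cell with a larger label is inside.\<close>

definition deficits :: "nat \<Rightarrow> (nat \<Rightarrow> nat) \<Rightarrow> nat \<Rightarrow> nat \<Rightarrow> nat" where
  "deficits n g a b = card ({k. k < b \<and> a < g k} \<union> {k. b \<le> k \<and> k < n \<and> g k < a})"

text \<open>The pairs of size \<open>N\<close> are the \<open>(N - b, b)\<close> with
  \<open>b\<close> in the given interval; its lower end encodes \<open>N - b <= m\<close>.\<close>

definition balanced :: "nat \<Rightarrow> nat \<Rightarrow> (nat \<Rightarrow> nat \<Rightarrow> nat) \<Rightarrow> bool" where
  "balanced m n D \<longleftrightarrow> (\<forall>N\<le>m + n. bij_betw (\<lambda>b. D (N - b) b)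
     {N - m..min n (N div 2)} {..min n (N div 2) - (N - m)})"

lemma finite_pairs [simp]: "finite (pairs m n)"
  by (rule finite_subset[of _ "{..m} \<times> {..n}"]) (auto simp: pairs_def)

section \<open>Subpartitions of a two-row shape\<close>

lemma cells_two_partition:
  "cells (two_partition a b) = Pair 0 ` {..<a} \<union> Pair 1 ` {..<b}"
  by (auto simp: cells_def two_partition_def split: if_splits)

lemma in_cells_two_partition:
  "(l, c) \<in> cells (two_partition a b) \<longleftrightarrow> l = 0 \<and> c < a \<or> l = 1 \<and> c < b"
  by (auto simp: cells_def two_partition_def)

lemma finite_cells_two_partition [simp]: "finite (cells (two_partition a b))"
  by (simp add: cells_two_partition)

lemma card_cells_two_partition [simp]: "card (cells (two_partition a b)) = a + b"
  unfolding cells_two_partition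
  by (subst card_Un_disjoint) (auto simp: card_image inj_on_def)

lemma subpartitions_two_partition:
  "subpartitions (two_partition m n) = (\<lambda>(a, b). two_partition a b) ` pairs m n"
proof (intro equalityI subsetI)
  fix u assume u: "u \<in> subpartitions (two_partition m n)"
  have sub: "c < two_partition m n l" if "c < u l" for l c
    using u that by (auto simp: subpartitions_def cells_def)
  have le: "u l \<le> two_partition m n l" for l
    using sub[of "two_partition m n l" l] by force
  have "u l = two_partition (u 0) (u 1) l" for l
    using le[of l] by (simp add: two_partition_def split: if_splits)
  then have "u = two_partition (u 0) (u 1)" by blast
  moreover have "u 1 \<le> u 0"
    using u by (auto simp: subpartitions_def is_partition_def antimono_def)
  moreover have "u 0 \<le> m" "u 1 \<le> n"
    using le[of 0] le[of 1] by (simp_all add: two_partition_def)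
  ultimately show "u \<in> (\<lambda>(a, b). two_partition a b) ` pairs m n"
    by (intro image_eqI[of _ _ "(u 0, u 1)"]) (auto simp: pairs_def)
next
  fix u assume "u \<in> (\<lambda>(a, b). two_partition a b) ` pairs m n"
  then obtain a b where ab: "u = two_partition a b" "b \<le> a" "a \<le> m" "b \<le> n"
    by (auto simp: pairs_def)
  have "finite {l. u l \<noteq> 0}"
    by (rule finite_subset[of _ "{..1}"]) (auto simp: ab two_partition_def)
  then show "u \<in> subpartitions (two_partition m n)"
    using ab by (auto simp: subpartitions_def is_partition_def antimono_def cells_def two_partition_def
        split: if_splits)
qed

lemma inj_two_partition: "inj_on (\<lambda>(a, b). two_partition a b) S"
proof (rule inj_onI, clarsimp)
  fix a b c d assume "two_partition a b = two_partition c d"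
  then have "two_partition a b 0 = two_partition c d 0" "two_partition a b 1 = two_partition c d 1"
    by simp_all
  then show "a = c \<and> b = d" by (simp add: two_partition_def)
qed

text \<open>The statistic \<open>S\<close> is left general so that both generating functions become
  sums over pairs of the same form.\<close>

lemma sum_subpartitions_two_partition:
  assumes "\<And>a b. b \<le> a \<Longrightarrow> a \<le> m \<Longrightarrow> b \<le> n \<Longrightarrow> S (two_partition a b) = a + b - D a b"
  shows "(\<Sum>u\<in>subpartitions (two_partition m n). qt_monom (area (two_partition m n) u) (S u)) =
         (\<Sum>(a, b)\<in>pairs m n. qt_monom (m + n - (a + b)) (a + b - D a b))"
  unfolding subpartitions_two_partition sum.reindex[OF inj_two_partition]
  by (intro sum.cong) (auto simp: area_def pairs_def assms)

section \<open>Coefficients of the generating polynomials\<close>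

lemma coeff_qt_monom: "coeff (coeff (qt_monom i j) x) y = (if i = x \<and> j = y then 1 else 0)"
  by (simp add: qt_monom_def)

text \<open>The area fixes \<open>a + b\<close>. By the bound on \<open>D\<close> the exponent of t
  is not truncated, so it then fixes the deficit number.\<close>

lemma coeff_sum_pairs:
  assumes D: "\<And>a b. (a, b) \<in> pairs m n \<Longrightarrow> D a b \<le> a + b" and N: "N \<le> m + n" "d \<le> N" "n \<le> m"
  shows "coeff (coeff (\<Sum>(a, b)\<in>pairs m n. qt_monom (m + n - (a + b)) (a + b - D a b)) (m + n - N)) (N - d)
    = int (card {b \<in> {N - m..min n (N div 2)}. D (N - b) b = d})"
proof -
  let ?B = "{b \<in> {N - m..min n (N div 2)}. D (N - b) b = d}"
  have eq: "{p \<in> pairs m n. m + n - (fst p + snd p) = m + n - N \<and>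
      fst p + snd p - D (fst p) (snd p) = N - d} = (\<lambda>b. (N - b, b)) ` ?B"
  proof (intro equalityI subsetI)
    fix p assume p: "p \<in> {p \<in> pairs m n. m + n - (fst p + snd p) = m + n - N \<and>
      fst p + snd p - D (fst p) (snd p) = N - d}"
    obtain a b where [simp]: "p = (a, b)" by (cases p)
    have ab: "b \<le> a" "a \<le> m" "b \<le> n" using p by (auto simp: pairs_def)
    then have "a + b = N" using p N by auto
    then have "a = N - b" "D a b = d" using p D[of a b] N by auto
    then show "p \<in> (\<lambda>b. (N - b, b)) ` ?B" using ab \<open>a + b = N\<close> by (auto simp: min_def)
  next
    fix p assume "p \<in> (\<lambda>b. (N - b, b)) ` ?B"
    then obtain b where b: "p = (N - b, b)" "N - m \<le> b" "b \<le> n" "b \<le> N div 2" "D (N - b) b = d"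
      by auto
    then have "b + b \<le> N" by linarith
    then show "p \<in> {p \<in> pairs m n. m + n - (fst p + snd p) = m + n - N \<and>
      fst p + snd p - D (fst p) (snd p) = N - d}" using b by (auto simp: pairs_def)
  qed
  have "coeff (coeff (\<Sum>(a, b)\<in>pairs m n. qt_monom (m + n - (a + b)) (a + b - D a b)) (m + n - N)) (N - d)
    = (\<Sum>p\<in>pairs m n. if m + n - (fst p + snd p) = m + n - N \<and>
      fst p + snd p - D (fst p) (snd p) = N - d then 1 else 0)"
    by (simp add: coeff_sum coeff_qt_monom split_def)
  also have "\<dots> = int (card {p \<in> pairs m n. m + n - (fst p + snd p) = m + n - N \<and>
      fst p + snd p - D (fst p) (snd p) = N - d})"
    by (subst sum.inter_filter[symmetric]) auto
  also have "\<dots> = int (card ?B)"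
    unfolding eq by (subst card_image) (auto simp: inj_on_def)
  finally show ?thesis .
qed

text \<open>Fibre sizes are what the coefficients record, so balance has to be expressed through
  them.\<close>

lemma bij_betw_atMost_iff_card_fibres:
  fixes f :: "nat \<Rightarrow> nat"
  assumes "finite A"
  shows "bij_betw f A {..k} \<longleftrightarrow> (\<forall>d. card {b \<in> A. f b = d} = of_bool (d \<le> k))"
proof
  assume bij: "bij_betw f A {..k}"
  show "\<forall>d. card {b \<in> A. f b = d} = of_bool (d \<le> k)"
  proof
    fix d
    show "card {b \<in> A. f b = d} = of_bool (d \<le> k)"
    proof (cases "d \<le> k")
      case True
      then have "d \<in> f ` A" using bij by (simp add: bij_betw_def)
      then obtain b where "b \<in> A" "f b = d" by blast
      then have "{b \<in> A. f b = d} = {b}" using bij by (auto simp: bij_betw_def inj_on_def)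
      then show ?thesis using True by simp
    next
      case False
      then have "d \<notin> f ` A" using bij by (simp add: bij_betw_def)
      then have no: "{b \<in> A. f b = d} = {}" by blast
      show ?thesis unfolding no using False by simp
    qed
  qed
next
  assume fib: "\<forall>d. card {b \<in> A. f b = d} = of_bool (d \<le> k)"
  show "bij_betw f A {..k}"
    unfolding bij_betw_def
  proof
    show "inj_on f A"
    proof (rule inj_onI)
      fix x y assume xy: "x \<in> A" "y \<in> A" "f x = f y"
      have "card {b \<in> A. f b = f x} \<le> 1" using fib by simp
      moreover have "finite {b \<in> A. f b = f x}" using assms by simp
      ultimately show "x = y" using xy card_le_Suc0_iff_eq[of "{b \<in> A. f b = f x}"] by simp
    qed
    have "d \<in> f ` A \<longleftrightarrow> d \<le> k" for d
    proof -
      have "d \<in> f ` A \<longleftrightarrow> {b \<in> A. f b = d} \<noteq> {}" by auto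
      also have "\<dots> \<longleftrightarrow> card {b \<in> A. f b = d} \<noteq> 0" using assms by simp
      also have "\<dots> \<longleftrightarrow> d \<le> k" using fib by simp
      finally show ?thesis .
    qed
    then show "f ` A = {..k}" by auto
  qed
qed

text \<open>The coefficients of each sum are the fibre sizes of its deficit function on each size
  \<open>N\<close>. Balance prescribes all of them, so agreeing with a balanced \<open>E\<close> is
  the same as being balanced.\<close>

lemma sum_pairs_eq_iff_balanced:
  assumes "n \<le> m"
    and D: "\<And>a b. (a, b) \<in> pairs m n \<Longrightarrow> D a b \<le> a + b"
    and E: "\<And>a b. (a, b) \<in> pairs m n \<Longrightarrow> E a b \<le> a + b" "balanced m n E"
  shows "(\<Sum>(a, b)\<in>pairs m n. qt_monom (m + n - (a + b)) (a + b - D a b)) =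
         (\<Sum>(a, b)\<in>pairs m n. qt_monom (m + n - (a + b)) (a + b - E a b)) \<longleftrightarrow> balanced m n D"
    (is "?S D = ?S E \<longleftrightarrow> _")
proof -
  let ?fib = "\<lambda>D N d. card {b \<in> {N - m..min n (N div 2)}. D (N - b) b = d}"
  let ?len = "\<lambda>N. min n (N div 2) - (N - m)"
  have bal: "balanced m n D \<longleftrightarrow> (\<forall>N\<le>m + n. \<forall>d. ?fib D N d = of_bool (d \<le> ?len N))" for D
    by (simp add: balanced_def bij_betw_atMost_iff_card_fibres)
  have empty: "?fib D N d = 0" if "N < d" "\<And>a b. (a, b) \<in> pairs m n \<Longrightarrow> D a b \<le> a + b" for D N d
  proof -
    have "D (N - b) b \<noteq> d" if "N - m \<le> b" "b \<le> n" "b \<le> N div 2" for b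
    proof -
      have "b \<le> N" "(N - b, b) \<in> pairs m n" using that by (auto simp: pairs_def)
      then show ?thesis using \<open>N < d\<close> \<open>\<And>a b. (a, b) \<in> pairs m n \<Longrightarrow> D a b \<le> a + b\<close>[of "N - b" b] by auto
    qed
    then have "{b \<in> {N - m..min n (N div 2)}. D (N - b) b = d} = {}" by auto
    then show ?thesis by simp
  qed
  \<comment> \<open>No exponent \<open>N - d\<close> belongs to a value \<open>d\<close> above
    \<open>N\<close>, hence the restriction to \<open>d <= N\<close>; the remaining fibres are
    empty.\<close>
  have eq: "?S D = ?S E \<longleftrightarrow> (\<forall>N\<le>m + n. \<forall>d\<le>N. ?fib D N d = ?fib E N d)"
  proof
    assume "?S D = ?S E"
    then show "\<forall>N\<le>m + n. \<forall>d\<le>N. ?fib D N d = ?fib E N d"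
      using coeff_sum_pairs[of m n D, OF D] coeff_sum_pairs[of m n E, OF E(1)] assms(1)
      by simp
  next
    assume fib: "\<forall>N\<le>m + n. \<forall>d\<le>N. ?fib D N d = ?fib E N d"
    have "coeff (coeff (?S D) x) y = coeff (coeff (?S E) x) y" for x y
    proof (cases "x \<le> m + n \<and> y \<le> m + n - x")
      case True
      define N where "N = m + n - x"
      have N: "x = m + n - N" "y = N - (N - y)" "N \<le> m + n" "N - y \<le> N"
        using True by (auto simp: N_def)
      show ?thesis
        using coeff_sum_pairs[of m n D N "N - y", OF D] coeff_sum_pairs[of m n E N "N - y", OF E(1)]
          fib N assms(1) by simp
    next
      case False
      have "coeff (coeff (?S D) x) y = 0" for D
      proof -
        have "coeff (coeff (qt_monom (m + n - (a + b)) (a + b - D a b)) x) y = 0"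
          if "(a, b) \<in> pairs m n" for a b
          using that False by (auto simp: coeff_qt_monom pairs_def)
        then show ?thesis
          by (auto simp: coeff_sum split_def intro!: sum.neutral)
      qed
      then show ?thesis by simp
    qed
    then show "?S D = ?S E" by (simp add: poly_eq_iff)
  qed
  have E_fib: "?fib E N d = of_bool (d \<le> ?len N)" if "N \<le> m + n" for N d
    using E(2) that unfolding bal by blast
  show ?thesis
    unfolding eq bal
  proof (intro iffI allI impI)
    fix N d assume *: "\<forall>N\<le>m + n. \<forall>d\<le>N. ?fib D N d = ?fib E N d" "N \<le> m + n"
    show "?fib D N d = of_bool (d \<le> ?len N)"
    proof (cases "d \<le> N")
      case True
      then have "?fib D N d = ?fib E N d" using * by blast
      then show ?thesis using E_fib[OF *(2), of d] by metis
    next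
      case False
      then have "?fib D N d = 0" "?fib E N d = 0"
        using empty[OF _ D] empty[OF _ E(1)] by auto
      then show ?thesis using E_fib[OF *(2), of d] by metis
    qed
  next
    fix N d assume *: "\<forall>N\<le>m + n. \<forall>d. ?fib D N d = of_bool (d \<le> ?len N)" "N \<le> m + n"
    have "?fib D N d = of_bool (d \<le> ?len N)" using * by blast
    then show "?fib D N d = ?fib E N d" using E_fib[OF *(2), of d] by metis
  qed
qed

section \<open>Deficit numbers as distances to an interval\<close>

lemma finite_downset_nat_eq_lessThan:
  fixes S :: "nat set"
  assumes "finite S" "\<And>x y. x \<in> S \<Longrightarrow> y < x \<Longrightarrow> y \<in> S"
  shows "S = {..<card S}"
proof -
  define k where "k = (LEAST x. x \<notin> S)"
  have "\<exists>x. x \<notin> S" using assms(1) by (metis infinite_UNIV_nat ex_new_if_finite)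
  then have "k \<notin> S" unfolding k_def by (metis LeastI)
  moreover have "x \<in> S" if "x < k" for x using that not_less_Least unfolding k_def by blast
  ultimately have "S = {..<k}" using assms(2)
    by (metis lessThan_iff linorder_neqE_nat subsetI subset_antisym)
  then show ?thesis by simp
qed

text \<open>The generalised inverse of a monotone \<open>g\<close>, with values cut off at
  \<open>n\<close>.\<close>

definition below :: "nat \<Rightarrow> (nat \<Rightarrow> nat) \<Rightarrow> nat \<Rightarrow> nat" where
  "below n g a = card {k. k < n \<and> g k < a}"

lemma below_mono: "a \<le> a' \<Longrightarrow> below n g a \<le> below n g a'"
  unfolding below_def by (intro card_mono) auto

lemma less_below_iff:
  assumes "\<And>j k. j \<le> k \<Longrightarrow> k < n \<Longrightarrow> g j \<le> g k"
  shows "k < below n g a \<longleftrightarrow> k < n \<and> g k < a"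
proof -
  have "{k. k < n \<and> g k < a} = {..<below n g a}"
    unfolding below_def
  proof (rule finite_downset_nat_eq_lessThan)
    fix x y assume "x \<in> {k. k < n \<and> g k < a}" "y < x"
    then show "y \<in> {k. k < n \<and> g k < a}" using assms[of y x] by simp
  qed simp
  then have "k \<in> {k. k < n \<and> g k < a} \<longleftrightarrow> k \<in> {..<below n g a}" by simp
  then show ?thesis by simp
qed

text \<open>Both sets are intervals of columns. Since \<open>below n g a\<close> is at most
  \<open>below n g (a + 1)\<close>, the sum is the distance from \<open>b\<close> to the interval
  between these two numbers.\<close>

lemma deficits_eq_below:
  assumes "\<And>j k. j \<le> k \<Longrightarrow> k < n \<Longrightarrow> g j \<le> g k" "b \<le> n"
  shows "deficits n g a b = (b - below n g (a + 1)) + (below n g a - b)"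
proof -
  have iff: "k < below n g a \<longleftrightarrow> k < n \<and> g k < a" for k a
    by (rule less_below_iff) (rule assms(1))
  have "a < g k \<longleftrightarrow> below n g (a + 1) \<le> k" if "k < b" for k
    using iff[of k "a + 1"] assms(2) that by (auto simp: not_less[symmetric])
  then have "{k. k < b \<and> a < g k} = {below n g (a + 1)..<b}" by auto
  moreover have "{k. b \<le> k \<and> k < n \<and> g k < a} = {b..<below n g a}"
    by (auto simp: iff)
  moreover have "below n g a \<le> below n g (a + 1)" by (rule below_mono) simp
  then have "{below n g (a + 1)..<b} \<inter> {b..<below n g a} = {}" by auto
  ultimately show ?thesis
    by (simp add: deficits_def card_Un_disjoint)
qed

lemma deficit_columns_subset:
  fixes g :: "nat \<Rightarrow> nat"
  assumes "\<And>k. k < n \<Longrightarrow> k \<le> g k" "b \<le> a" "b \<le> n"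
  shows "{k. k < b \<and> a < g k} \<union> {k. b \<le> k \<and> k < n \<and> g k < a} \<subseteq> {..<a}"
proof -
  have "k < a" if "k < n" "g k < a" for k using assms(1)[OF that(1)] that(2) by linarith
  then show ?thesis using assms(2) by auto
qed

section \<open>Consecutive and exceptional sequences are balanced\<close>

lemma bij_betw_atMost_if_inj:
  fixes f :: "nat \<Rightarrow> nat"
  assumes "lo \<le> hi" "inj_on f {lo..hi}" "\<And>b. lo \<le> b \<Longrightarrow> b \<le> hi \<Longrightarrow> f b \<le> hi - lo"
  shows "bij_betw f {lo..hi} {..hi - lo}"
proof -
  have "f ` {lo..hi} = {..hi - lo}"
    by (rule card_subset_eq) (use assms in \<open>auto simp: card_image\<close>)
  then show ?thesis using assms(2) by (simp add: bij_betw_def)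
qed

text \<open>Pigeonhole: there are as many admissible \<open>b\<close> as allowed values, so the
  upper bound and injectivity already give surjectivity.\<close>

lemma balancedI:
  assumes "n \<le> m"
    and le: "\<And>N b. N - m \<le> b \<Longrightarrow> b \<le> n \<Longrightarrow> 2 * b \<le> N \<Longrightarrow> D (N - b) b \<le> min n (N div 2) - (N - m)"
    and inj: "\<And>N b b'. b < b' \<Longrightarrow> N - m \<le> b \<Longrightarrow> b' \<le> n \<Longrightarrow> 2 * b' \<le> N \<Longrightarrow> D (N - b) b \<noteq> D (N - b') b'"
  shows "balanced m n D"
  unfolding balanced_def
proof (intro allI impI bij_betw_atMost_if_inj)
  fix N assume "N \<le> m + n"
  then show "N - m \<le> min n (N div 2)" using assms(1) by auto
  show "inj_on (\<lambda>b. D (N - b) b) {N - m..min n (N div 2)}"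
  proof (rule linorder_inj_onI')
    fix b b' assume "b \<in> {N - m..min n (N div 2)}" "b' \<in> {N - m..min n (N div 2)}" "b < b'"
    then show "D (N - b) b \<noteq> D (N - b') b'" by (intro inj) auto
  qed
next
  fix N b assume "N - m \<le> b" "b \<le> min n (N div 2)"
  then show "D (N - b) b \<le> min n (N div 2) - (N - m)" by (intro le) auto
qed

text \<open>The two minima are \<open>below n g (a + 1)\<close> and \<open>below n g a\<close> for
  \<open>g k = s + k\<close>. The distance is bounded separately on each side of the
  interval.\<close>

lemma clamped_deficits_le:
  fixes n s m a b :: nat
  assumes "n \<le> s" "s + n \<le> m + 1" "b \<le> n" "b \<le> a" "a \<le> m"
  shows "(b - min n (a + 1 - s)) + (min n (a - s) - b) \<le> min n ((a + b) div 2) - (a + b - m)"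
proof -
  define p where "p = min n (a - s)"
  define q where "q = min n (a + 1 - s)"
  have pq: "p \<le> n" "p \<le> a - s" "p = n \<or> p = a - s" "q \<le> n" "q = n \<or> a + 1 \<le> s + q" "p \<le> q"
    unfolding p_def q_def by linarith+
  \<comment> \<open>Without truncation the bound is a pair of linear inequalities for sizes up to
    \<open>m\<close> and another pair for larger sizes.\<close>
  have 1: "z \<le> min n ((a + b) div 2) - (a + b - m)"
    if "a + b \<le> m \<longrightarrow> z \<le> n \<and> 2 * z \<le> a + b"
       "m < a + b \<longrightarrow> a + b + z \<le> n + m \<and> a + b + 2 * z \<le> 2 * m" for z
    using that assms by linarith
  show ?thesis
  proof (cases "b \<le> q")
    case True
    have "p - b \<le> min n ((a + b) div 2) - (a + b - m)"
    proof (rule 1; intro impI conjI)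
    qed (use pq assms in linarith)+
    then show ?thesis unfolding p_def[symmetric] q_def[symmetric] using True by simp
  next
    case False
    have "b - q \<le> min n ((a + b) div 2) - (a + b - m)"
    proof (rule 1; intro impI conjI)
    qed (use pq assms in linarith)+
    then show ?thesis unfolding p_def[symmetric] q_def[symmetric] using False pq by simp
  qed
qed

text \<open>
  The left side comes from the longer bottom row. If \<open>b\<close> lies below its interval and \<open>k + b\<close> above
  its own, the two distances can only agree if \<open>2 b + k = p + q'\<close>, which parity excludes.
\<close>
lemma clamped_deficits_neq:
  fixes n s a b k :: nat
  assumes "k + b \<le> n" "k > 0"
  shows "(b - min n (a + k + 1 - s)) + (min n (a + k - s) - b) \<noteq>
    (k + b - min n (a + 1 - s)) + (min n (a - s) - (k + b))"
proof -
  define p where "p = min n (a + k - s)"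
  define p' where "p' = min n (a + k + 1 - s)"
  define q where "q = min n (a - s)"
  define q' where "q' = min n (a + 1 - s)"
  \<comment> \<open>Each interval has length at most one, and the interval of the longer row starts
    no lower than the other one ends.\<close>
  have chain: "q \<le> q'" "q' \<le> q + 1" "q' \<le> p" "p \<le> p'" "p' \<le> p + 1"
    unfolding p_def q_def p'_def q'_def using assms by linarith+
  have pq: "2 * b + k \<noteq> p + q'"
  proof
    assume eq: "2 * b + k = p + q'"
    show False
    proof (cases "s \<le> a")
      case True
      then obtain x where x: "a = s + x" using le_iff_add by auto
      have "p = min n (x + k)" "q' = min n (x + 1)" by (simp_all add: p_def q'_def x)
      \<comment> \<open>If neither minimum is cut off at \<open>n\<close>, the right side is
        \<open>2 * x + k + 1\<close>, of the wrong parity; otherwise \<open>k + b <= n\<close> rules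
        the equation out.\<close>
      then show False using eq assms by (cases "n \<le> x + k"; cases "n \<le> x + 1"; simp; presburger)
    next
      case False
      then have "q' = 0" "a + k - s < k" using assms by (simp_all add: q'_def)
      moreover have "p \<le> a + k - s" by (simp add: p_def)
      ultimately show False using eq by linarith
    qed
  qed
  show ?thesis
    unfolding p_def[symmetric] q_def[symmetric] p'_def[symmetric] q'_def[symmetric]
    using chain pq assms
    by (cases "b \<le> p"; cases "k + b \<le> q"; simp; linarith)
qed

text \<open>Here \<open>below n g a\<close> is \<open>a - s\<close> cut off at 0 and
  \<open>n\<close>, so the two lemmas on clamped differences give the bound and the
  injectivity.\<close>

lemma balanced_consecutive:
  assumes "n \<le> s" "s + n \<le> m + 1" and g: "\<And>k. k < n \<Longrightarrow> g k = s + k"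
  shows "balanced m n (deficits n g)"
proof -
  have mono: "g j \<le> g k" if "j \<le> k" "k < n" for j k using that g by simp
  have "{k. k < n \<and> g k < a} = {..<min n (a - s)}" for a using g by auto
  then have h: "below n g a = min n (a - s)" for a by (simp add: below_def)
  have D: "deficits n g a b = (b - min n (a + 1 - s)) + (min n (a - s) - b)" if "b \<le> n" for a b
    using deficits_eq_below[of n g b a] mono that by (simp add: h)
  show ?thesis
  proof (rule balancedI)
    show "n \<le> m" using assms by linarith
  next
    fix N b assume "N - m \<le> b" "b \<le> n" "2 * b \<le> N"
    then show "deficits n g (N - b) b \<le> min n (N div 2) - (N - m)"
      using clamped_deficits_le[of n s m b "N - b"] assms(1,2) by (simp add: D)
  next
    fix N b b' assume *: "b < b'" "N - m \<le> b" "b' \<le> n" "2 * b' \<le> N"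
    then have "b \<le> n" by simp
    show "deficits n g (N - b) b \<noteq> deficits n g (N - b') b'"
      using clamped_deficits_neq[of "b' - b" b n "N - b'" s] * by (simp add: D)
  qed
qed

text \<open>The function \<open>below 2 g\<close> steps up only at 2 and at 4, so the three values
  of \<open>b\<close> give the short formulas \<open>D0\<close>, \<open>D1\<close> and
  \<open>D2\<close>, which are compared case by case.\<close>

lemma balanced_exceptional:
  assumes "3 \<le> m" "g 0 = 1" "g 1 = 3"
  shows "balanced m 2 (deficits 2 g)"
proof -
  have mono: "g j \<le> g k" if "j \<le> k" "k < 2" for j k
    using that assms by (cases j; cases k) (auto simp: less_Suc_eq numeral_2_eq_2)
  have "{k. k < 2 \<and> g k < a} = {..<if a \<le> 1 then 0 else if a \<le> 3 then 1 else 2}" for a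
    using assms by (auto simp: less_2_cases_iff intro: gr0I)
  then have h: "below 2 g a = (if a \<le> 1 then 0 else if a \<le> 3 then 1 else 2)" for a
    by (simp add: below_def)
  have D: "deficits 2 g a b = (b - (if a = 0 then 0 else if a \<le> 2 then 1 else 2)) +
      ((if a \<le> 1 then 0 else if a \<le> 3 then 1 else 2) - b)" if "b \<le> 2" for a b
    using deficits_eq_below[of 2 g b a] mono that by (simp add: h)
  have D0: "deficits 2 g a 0 = of_bool (2 \<le> a) + of_bool (4 \<le> a)" for a
    by (simp add: D)
  have D1: "deficits 2 g a (Suc 0) = of_bool (4 \<le> a)" if "1 \<le> a" for a
    using that by (simp add: D)
  have D2: "deficits 2 g a 2 = of_bool (a = 2)" if "2 \<le> a" for a
    using that by (simp add: D)
  show ?thesis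
  proof (rule balancedI)
    show "2 \<le> m" using assms by linarith
  next
    fix N b :: nat assume *: "N - m \<le> b" "b \<le> 2" "2 * b \<le> N"
    have small: "min 2 (N div 2) - (N - m) = of_bool (2 \<le> N) + of_bool (4 \<le> N)" if "N \<le> m"
    proof -
      consider "N < 2" | "N = 2" | "N = 3" | "4 \<le> N" by linarith
      then show ?thesis using that by cases simp_all
    qed
    have large: "min 2 (N div 2) - (N - m) = 2 - (N - m)" if "m < N"
      using that assms(1) by simp
    \<comment> \<open>Since \<open>N - b <= m\<close>, the size exceeds \<open>m\<close> by at most
      \<open>b\<close>, which leaves six cases.\<close>
    from * consider "b = 0" "N \<le> m" | "b = 1" "N \<le> m" | "b = 1" "N = m + 1"
      | "b = 2" "N \<le> m" | "b = 2" "N = m + 1" | "b = 2" "N = m + 2" by linarith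
    then show "deficits 2 g (N - b) b \<le> min 2 (N div 2) - (N - m)"
    proof cases
      case 1
      then show ?thesis using small by (simp add: D0)
    next
      case 2
      then show ?thesis using small * by (simp add: D1)
    next
      case 3
      then show ?thesis using large * by (simp add: D1)
    next
      case 4
      then show ?thesis using small * by (simp add: D2)
    next
      case 5
      then show ?thesis using large * by (simp add: D2)
    next
      case 6
      then show ?thesis using large * assms(1) by (simp add: D2)
    qed
  next
    fix N b b' :: nat assume *: "b < b'" "N - m \<le> b" "b' \<le> 2" "2 * b' \<le> N"
    then consider "b = 0" "b' = 1" | "b = 0" "b' = 2" | "b = 1" "b' = 2" by linarith
    then show "deficits 2 g (N - b) b \<noteq> deficits 2 g (N - b') b'"
      using * by cases (auto simp: D0 D1 D2)
  qed
qed

section \<open>Balanced sequences are consecutive or exceptional\<close>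

lemma balancedD_le:
  assumes "balanced m n D" "b \<le> a" "a \<le> m" "b \<le> n"
  shows "D a b \<le> min n ((a + b) div 2) - (a + b - m)"
proof -
  have "bij_betw (\<lambda>c. D (a + b - c) c) {a + b - m..min n ((a + b) div 2)}
      {..min n ((a + b) div 2) - (a + b - m)}"
    using assms by (simp add: balanced_def)
  moreover have "b \<in> {a + b - m..min n ((a + b) div 2)}" using assms by auto
  ultimately have "D (a + b - b) b \<in> {..min n ((a + b) div 2) - (a + b - m)}"
    by (rule bij_betw_apply)
  then show ?thesis by simp
qed

text \<open>Both pairs have size \<open>c + a + b\<close>, so injectivity separates them; the shift
  \<open>c\<close> avoids truncated subtraction.\<close>

lemma balancedD_neq:
  assumes "balanced m n D" "c + b \<le> a" "c + a \<le> m" "c + b \<le> n" "c > 0"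
  shows "D (c + a) b \<noteq> D a (c + b)"
proof -
  let ?N = "c + (a + b)"
  have "inj_on (\<lambda>b. D (?N - b) b) {?N - m..min n (?N div 2)}"
    using assms unfolding balanced_def bij_betw_def by simp
  moreover have "b \<in> {?N - m..min n (?N div 2)}" "c + b \<in> {?N - m..min n (?N div 2)}"
    using assms by auto
  ultimately have "D (?N - b) b = D (?N - (c + b)) (c + b) \<longleftrightarrow> b = c + b"
    by (rule inj_on_eq_iff)
  then show ?thesis using assms(5) by simp
qed

text \<open>The conditions place \<open>d\<close> in the prescribed range of values, so surjectivity
  applies.\<close>

lemma balancedD_ex:
  assumes "balanced m n D" "N \<le> m + n" "d + (N - m) \<le> n" "2 * (d + (N - m)) \<le> N"
  obtains a b where "a + b = N" "b \<le> a" "a \<le> m" "b \<le> n" "D a b = d"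
proof -
  have "bij_betw (\<lambda>b. D (N - b) b) {N - m..min n (N div 2)} {..min n (N div 2) - (N - m)}"
    using assms by (simp add: balanced_def)
  then have "{..min n (N div 2) - (N - m)} = (\<lambda>b. D (N - b) b) ` {N - m..min n (N div 2)}"
    by (simp add: bij_betw_def)
  moreover have "d \<in> {..min n (N div 2) - (N - m)}"
    using assms(3,4) by (simp add: le_diff_conv2)
  ultimately obtain b where "b \<in> {N - m..min n (N div 2)}" "D (N - b) b = d"
    by (metis (no_types, lifting) imageE)
  then show ?thesis using that[of "N - b" b] by auto
qed

text \<open>A repeated value makes deficit number 1 unattainable on some diagonal, and an increment
  of at least 2 makes it occur twice unless \<open>g k = k + 1\<close>. The bound on one-row
  subpartitions then admits such an increment only at \<open>k = 0\<close>, which leads to the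
  exceptional pair. Without such an increment \<open>g\<close> is consecutive.\<close>

lemma balanced_imp:
  assumes bal: "balanced m n (deficits n g)" and "2 \<le> n" and m: "2 * n \<le> m + 1"
    and mono: "\<And>j k. j \<le> k \<Longrightarrow> k < n \<Longrightarrow> g j \<le> g k"
    and lower: "\<And>k. k < n \<Longrightarrow> k < g k" and upper: "\<And>k. k < n \<Longrightarrow> g k \<le> m"
  shows "(\<exists>s. n \<le> s \<and> s + n \<le> m + 1 \<and> (\<forall>k<n. g k = s + k)) \<or> n = 2 \<and> g 0 = 1 \<and> g 1 = 3"
proof -
  define h where "h = below n g"
  have h: "k < h a \<longleftrightarrow> k < n \<and> g k < a" for k a
    unfolding h_def by (rule less_below_iff) (rule mono)
  have h_mono: "h a \<le> h a'" if "a \<le> a'" for a a' unfolding h_def using that by (rule below_mono)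
  have D: "deficits n g a b = (b - h (a + 1)) + (h a - b)" if "b \<le> n" for a b
    unfolding h_def by (rule deficits_eq_below) (use mono that in auto)
  have strict: "g k < g (k + 1)" if k: "k + 1 < n" for k
  proof (rule ccontr)
    assume "\<not> g k < g (k + 1)"
    then have eq: "g (k + 1) = g k" using mono[of k "k + 1"] k by simp
    define p where "p = g k"
    define i where "i = h p"
    have "i \<le> k" using h[of k p] by (simp add: i_def p_def)
    have "p \<le> m" using upper[of k] k by (simp add: p_def)
    \<comment> \<open>Two columns with the same value \<open>p\<close> make \<open>h\<close> jump by
      at least 2 between \<open>p\<close> and \<open>p + 1\<close>.\<close>
    have "k + 1 < h (p + 1)" using h[of "k + 1" "p + 1"] k eq by (simp add: p_def)
    then have up: "i + 2 \<le> h (p + 1)" using \<open>i \<le> k\<close> by simp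
    have in_: "i + 2 \<le> n" using \<open>i \<le> k\<close> k by simp
    \<comment> \<open>On this diagonal the deficit number 0 is attained at \<open>(p, i + 1)\<close>, but all others are at
      least 2.\<close>
    obtain a b where ab: "a + b = p + i + 1" "b \<le> a" "a \<le> m" "b \<le> n" "deficits n g a b = 1"
    proof (rule balancedD_ex[OF bal])
      show "p + i + 1 \<le> m + n" using \<open>p \<le> m\<close> in_ by linarith
      show "1 + (p + i + 1 - m) \<le> n" using \<open>p \<le> m\<close> in_ by linarith
      have "p \<ge> 1" using lower[of k] k by (simp add: p_def)
      \<comment> \<open>This covers sizes \<open>N\<close> above \<open>m\<close>, where value 1 is
        in range only if \<open>N + 2 <= 2 * m\<close>.\<close>
      moreover have "p + i + 3 \<le> 2 * m" using \<open>p \<le> m\<close> in_ m \<open>2 \<le> n\<close> by linarith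
      ultimately show "2 * (1 + (p + i + 1 - m)) \<le> p + i + 1"
        by (cases "p + i + 1 \<le> m") simp_all
    qed
    consider "a < p" | "a = p" | "p < a" by linarith
    then show False
    proof cases
      case 1
      then have "h (a + 1) \<le> i" unfolding i_def by (intro h_mono) simp
      moreover have "i + 2 \<le> b" using 1 ab(1) by linarith
      ultimately show False using ab(5) D[OF ab(4), of a] by linarith
    next
      case 2
      then have "b = i + 1" using ab(1) by simp
      then show False using ab(5) D[OF ab(4), of a] up unfolding 2 i_def by linarith
    next
      case 3
      then have "h (p + 1) \<le> h a" by (intro h_mono) simp
      moreover have "b \<le> i" using 3 ab(1) by linarith
      ultimately show False using ab(5) D[OF ab(4), of a] up by linarith
    qed
  qed
  have gap: "g k = k + 1" if k: "k + 1 < n" "g k + 2 \<le> g (k + 1)" for k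
  proof (rule ccontr)
    assume "g k \<noteq> k + 1"
    define p where "p = g k"
    \<comment> \<open>These bounds make \<open>(p, k + 2)\<close> and \<open>(p + 2, k)\<close>
      admissible; the first one needs \<open>g k\<close> to differ from
      \<open>k + 1\<close>.\<close>
    have p: "k + 2 \<le> p" "p + 2 \<le> m"
      using \<open>g k \<noteq> k + 1\<close> lower[of k] upper[of "k + 1"] k by (simp_all add: p_def)
    have hi: "h a = k + 1" if "p < a" "a \<le> p + 2" for a
      using h[of k a] h[of "k + 1" a] k that by (simp add: p_def)
    have "\<not> k < h p" using h[of k p] by (simp add: p_def)
    \<comment> \<open>The zero of this diagonal, \<open>(p + 1, k + 1)\<close>, has deficit number 1 on both sides.\<close>
    have "deficits n g (2 + p) k = 1"
    proof -
      have "h (2 + p) = k + 1" by (rule hi) auto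
      moreover have "h (2 + p) \<le> h (2 + p + 1)" by (rule h_mono) simp
      moreover have "deficits n g (2 + p) k = (k - h (2 + p + 1)) + (h (2 + p) - k)"
        by (rule D) (use k in simp)
      ultimately show ?thesis by linarith
    qed
    moreover have "deficits n g p (2 + k) = 1"
    proof -
      have "h (p + 1) = k + 1" by (rule hi) auto
      moreover have "deficits n g p (2 + k) = (2 + k - h (p + 1)) + (h p - (2 + k))"
        by (rule D) (use k in simp)
      ultimately show ?thesis using \<open>\<not> k < h p\<close> by linarith
    qed
    moreover have "deficits n g (2 + p) k \<noteq> deficits n g p (2 + k)"
      by (rule balancedD_neq[OF bal]) (use p k in simp_all)
    ultimately show False by simp
  qed
  \<comment> \<open>The one-row subpartition with \<open>N\<close> cells has deficit number
    \<open>h N\<close>, and balance bounds it.\<close>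
  have h_half: "h N \<le> N div 2" if "N \<le> m" for N
    using balancedD_le[OF bal, of 0 N] D[of 0 N] that by simp
  show ?thesis
  proof (cases "\<exists>k. k + 1 < n \<and> g k + 2 \<le> g (k + 1)")
    case False
    have g: "g k = g 0 + k" if "k < n" for k
      using that
    proof (induction k)
      case (Suc k)
      then have "g k < g (k + 1)" "\<not> g k + 2 \<le> g (k + 1)" using strict[of k] False by auto
      then show ?case using Suc by simp
    qed simp
    have last: "g (n - 1) = g 0 + (n - 1)" by (rule g) (use \<open>2 \<le> n\<close> in simp)
    then have "g 0 + n \<le> m + 1" using upper[of "n - 1"] \<open>2 \<le> n\<close> by simp
    moreover have "n \<le> g 0"
    proof (rule ccontr)
      assume "\<not> n \<le> g 0"
      \<comment> \<open>A start below \<open>n\<close> would put all \<open>n\<close> values below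
        \<open>2 * n - 1\<close>, more than the half allowed by \<open>h_half\<close>.\<close>
      then have "n - 1 < h (2 * n - 1)" using h[of "n - 1" "2 * n - 1"] last \<open>2 \<le> n\<close> by simp
      also have "h (2 * n - 1) \<le> (2 * n - 1) div 2" by (rule h_half) (use m in simp)
      finally show False by linarith
    qed
    ultimately show ?thesis using g by blast
  next
    case True
    then obtain k where k: "k + 1 < n" "g k + 2 \<le> g (k + 1)" by blast
    have at_0: "j = 0" if j: "j + 1 < n" "g j + 2 \<le> g (j + 1)" for j
    proof -
      have "g j = j + 1" by (rule gap) (use j in auto)
      \<comment> \<open>At least \<open>j + 1\<close> values lie below \<open>j + 2\<close>, so
        \<open>h_half\<close> leaves only \<open>j = 0\<close>.\<close>
      then have "j < h (j + 2)" "j + 2 \<le> m" using h[of j "j + 2"] upper[of "j + 1"] j by simp_all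
      then show "j = 0" using h_half[of "j + 2"] by simp
    qed
    then have "k = 0" using k by blast
    then have g0: "g 0 = 1" and g1: "3 \<le> g 1" using gap[of 0] k by simp_all
    have "g 1 = 3"
    proof (rule ccontr)
      assume "g 1 \<noteq> 3"
      then have "4 \<le> g 1" using g1 by simp
      then have "4 \<le> m" using upper[of 1] \<open>2 \<le> n\<close> by simp
      \<comment> \<open>With \<open>h\<close> constant from 2 to 4, the pairs \<open>(4, 0)\<close>
        and \<open>(2, 2)\<close> of size 4 are both at distance 1.\<close>
      have hi: "h a = 1" if "2 \<le> a" "a \<le> 4" for a
        using h[of 0 a] h[of 1 a] g0 \<open>4 \<le> g 1\<close> \<open>2 \<le> n\<close> that by simp
      have "deficits n g (2 + 2) 0 = 1" "deficits n g 2 (2 + 0) = 1"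
        using D[of 0 4] D[of 2 2] hi[of 2] hi[of 3] hi[of 4] \<open>2 \<le> n\<close> by simp_all
      moreover have "deficits n g (2 + 2) 0 \<noteq> deficits n g 2 (2 + 0)"
        by (rule balancedD_neq[OF bal]) (use \<open>2 \<le> n\<close> \<open>4 \<le> m\<close> in simp_all)
      ultimately show False by simp
    qed
    moreover have "n = 2"
    proof (rule ccontr)
      assume "n \<noteq> 2"
      then have "3 \<le> n" using \<open>2 \<le> n\<close> by simp
      have "\<not> g 1 + 2 \<le> g (1 + 1)" using at_0[of 1] \<open>3 \<le> n\<close> by linarith
      then have "g 2 < 5" using \<open>g 1 = 3\<close> by (simp add: numeral_2_eq_2)
      \<comment> \<open>Three values below 5 would exceed the half allowed by
        \<open>h_half\<close>.\<close>
      then have "2 < h 5" using h[of 2 5] \<open>3 \<le> n\<close> by simp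
      also have "h 5 \<le> 5 div 2" by (rule h_half) (use m \<open>3 \<le> n\<close> in simp)
      finally show False by simp
    qed
    ultimately show ?thesis using g0 by simp
  qed
qed

section \<open>From deficit columns to cell counts\<close>

lemma deficits_le:
  fixes g :: "nat \<Rightarrow> nat"
  assumes "\<And>k. k < n \<Longrightarrow> k \<le> g k" "b \<le> a" "b \<le> n"
  shows "deficits n g a b \<le> a"
  unfolding deficits_def using card_mono[OF _ deficit_columns_subset[OF assms]] by simp

text \<open>Serves both statistics: similar cells and non-deficit cells are complements of the same
  kind of column set in the bottom row.\<close>

lemma card_cells_minus_deficit_columns:
  fixes g :: "nat \<Rightarrow> nat"
  assumes "\<And>k. k < n \<Longrightarrow> k \<le> g k" "b \<le> a" "b \<le> n"
  shows "card (cells (two_partition a b) -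
      Pair 0 ` ({k. k < b \<and> a < g k} \<union> {k. b \<le> k \<and> k < n \<and> g k < a})) = a + b - deficits n g a b"
    (is "card (_ - Pair 0 ` ?X) = _")
proof -
  have X: "?X \<subseteq> {..<a}" using assms by (rule deficit_columns_subset)
  then have "Pair 0 ` ?X \<subseteq> cells (two_partition a b)" by (auto simp: in_cells_two_partition)
  moreover have "finite (Pair (0::nat) ` ?X)" using finite_subset[OF X] by simp
  moreover have "card (Pair (0::nat) ` ?X) = deficits n g a b"
    unfolding deficits_def by (rule card_image) (simp add: inj_on_def)
  ultimately show ?thesis by (simp add: card_Diff_subset)
qed

section \<open>Triangularity and similar cells\<close>

text \<open>With \<open>d = r / s\<close> the numbers \<open>r - d\<close>,
  \<open>r - 2 * d\<close>, \<open>r - 3 * d\<close> are in arithmetic progression. The first is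
  below \<open>m + 1\<close>, the third below 1, and twice the middle one, which is at least
  \<open>n\<close>, is their sum.\<close>

lemma triangular_two_partition:
  assumes "triangular (two_partition m n)" "0 < n"
  shows "2 * n \<le> m + 1"
proof -
  obtain r s :: real where rs: "r > 0" "s > 0"
    and le: "\<And>j. j \<ge> 1 \<Longrightarrow> real j \<le> s \<Longrightarrow> int (two_partition m n (j - 1)) = \<lfloor>r - real j * r / s\<rfloor>"
    and gt: "\<And>j. j \<ge> 1 \<Longrightarrow> real j > s \<Longrightarrow> two_partition m n (j - 1) = 0"
    using assms(1) unfolding triangular_def by blast
  define d where "d = r / s"
  have "d > 0" using rs by (simp add: d_def)
  have "2 \<le> s" using gt[of 2] assms(2) by (force simp: two_partition_def)
  have "int m = \<lfloor>r - d\<rfloor>" using le[of 1] \<open>2 \<le> s\<close> by (simp add: two_partition_def d_def)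
  then have 1: "r - d < real m + 1" by linarith
  have "int n = \<lfloor>r - 2 * d\<rfloor>" using le[of 2] \<open>2 \<le> s\<close> by (simp add: two_partition_def d_def)
  then have 2: "real n \<le> r - 2 * d" by linarith
  \<comment> \<open>The third row is empty either because its floor is 0 or because
    \<open>s < 3\<close>.\<close>
  have 3: "r - 3 * d < 1"
  proof (cases "3 \<le> s")
    case True
    then have "0 = \<lfloor>r - 3 * d\<rfloor>" using le[of 3] by (simp add: two_partition_def d_def)
    then show ?thesis by linarith
  next
    case False
    then have "r < 3 * d" using rs by (simp add: d_def field_simps)
    then show ?thesis by simp
  qed
  have "2 * real n < real m + 2" using 1 2 3 by linarith
  then show ?thesis by linarith
qed

lemma two_partition_simps [simp]: "two_partition a b 0 = a" "two_partition a b (Suc 0) = b"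
  by (simp_all add: two_partition_def)

lemma arm_two_partition: "arm (l, c) (two_partition a b) = two_partition a b l - Suc c"
proof -
  have "{c'. snd (l, c) < c' \<and> (fst (l, c), c') \<in> cells (two_partition a b)} =
      {Suc c..<two_partition a b l}"
    by (auto simp: cells_def)
  then show ?thesis unfolding arm_def by simp
qed

lemma leg_two_partition:
  "leg (0, c) (two_partition a b) = (if c < b then 1 else 0)"
  "leg (Suc 0, c) (two_partition a b) = 0"
proof -
  have "{l'. fst (0, c) < l' \<and> (l', snd (0::nat, c)) \<in> cells (two_partition a b)} = (if c < b then {1} else {})"
    by (auto simp: in_cells_two_partition)
  then show "leg (0, c) (two_partition a b) = (if c < b then 1 else 0)"
    unfolding leg_def by simp
  have "{l'. fst (Suc 0, c) < l' \<and> (l', snd (Suc 0, c)) \<in> cells (two_partition a b)} = {}"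
    by (auto simp: in_cells_two_partition)
  then show "leg (Suc 0, c) (two_partition a b) = 0"
    unfolding leg_def by (simp only: card.empty)
qed

lemma slopes_two_partition:
  "c < b \<Longrightarrow> c < a \<Longrightarrow> v_minus (0, c) (two_partition a b) = 1 / real (a - c + 1)"
  "c < b \<Longrightarrow> c < a \<Longrightarrow> v_plus (0, c) (two_partition a b) = 2 / real (a - c + 1)"
  "b \<le> c \<Longrightarrow> v_minus (0, c) (two_partition a b) = 0"
  "b \<le> c \<Longrightarrow> c < a \<Longrightarrow> v_plus (0, c) (two_partition a b) = 1 / real (a - c)"
  "v_minus (Suc 0, c) (two_partition a b) = 0"
  "c < b \<Longrightarrow> v_plus (Suc 0, c) (two_partition a b) = 1 / real (b - c)"
  by (simp_all add: v_minus_def v_plus_def arm_two_partition leg_two_partition)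

text \<open>The mean slope \<open>t\<close> lies strictly between the two extrema. Evaluating these
  at a few corner cells bounds \<open>F\<close>, the integral part of \<open>1 / t\<close>, and
  settles all slope comparisons except one per bottom cell.\<close>

lemma sim_two_partition:
  assumes "n \<le> m" and tri: "0 < n \<Longrightarrow> 2 * n \<le> m + 1"
  obtains F where "0 < n \<Longrightarrow> n \<le> F" "0 < n \<Longrightarrow> F + n \<le> m + 1"
    "\<And>a b. b \<le> a \<Longrightarrow> a \<le> m \<Longrightarrow> b \<le> n \<Longrightarrow>
       sim (two_partition m n) (two_partition a b) = a + b - deficits n (\<lambda>k. F + k) a b"
proof (cases "m = 0")
  \<comment> \<open>The extrema over the empty cell set are unspecified, so the empty shape is
    treated apart.\<close>
  case True
  then have "sim (two_partition m n) (two_partition a b) = 0" if "b \<le> a" "a \<le> m" for a b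
    using that by (simp add: sim_def similar_cell_def in_cells_two_partition cells_two_partition)
  then show ?thesis using that[of 0] assms True by simp
next
  case False
  let ?p = "two_partition m n"
  define M where "M = max_v_minus ?p"
  define w where "w = min_v_plus ?p"
  define t where "t = (M + w) / 2"
  have ne: "cells ?p \<noteq> {}" using False by (auto simp: cells_two_partition)
  have M: "v_minus d ?p \<le> M" if "d \<in> cells ?p" for d
    unfolding M_def max_v_minus_def using that by (intro Max_ge) auto
  have w: "w \<le> v_plus d ?p" if "d \<in> cells ?p" for d
    unfolding w_def min_v_plus_def using that by (intro Min_le) auto
  have "M \<in> (\<lambda>d. v_minus d ?p) ` cells ?p"
    unfolding M_def max_v_minus_def using ne by (intro Max_in) auto
  then obtain d\<^sub>1 where d1: "d\<^sub>1 \<in> cells ?p" "M = v_minus d\<^sub>1 ?p" by blast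
  have "w \<in> (\<lambda>d. v_plus d ?p) ` cells ?p"
    unfolding w_def min_v_plus_def using ne by (intro Min_in) auto
  then obtain d\<^sub>2 where d2: "d\<^sub>2 \<in> cells ?p" "w = v_plus d\<^sub>2 ?p" by blast
  have "M \<ge> 0" unfolding d1(2) by (simp add: v_minus_def)
  have "w > 0" unfolding d2(2) by (simp add: v_plus_def)
  have "M < w"
  proof (cases "n = 0")
    case True
    then have "M = 0" using d1 by (cases d\<^sub>1) (auto simp: in_cells_two_partition slopes_two_partition)
    then show ?thesis using \<open>w > 0\<close> by simp
  next
    case False
    then have n_pos: "0 < n" by simp
    \<comment> \<open>The separating value is \<open>v_minus\<close> at \<open>(0, n - 1)\<close>,
      the last bottom cell with a cell above it.\<close>
    have "M \<le> 1 / real (m - n + 2)"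
    proof -
      obtain l c where lc: "d\<^sub>1 = (l, c)" by fastforce
      then consider "l = 0" "c < n" "c < m" | "l = 0" "n \<le> c" | "l = Suc 0"
        using d1(1) assms(1) by (fastforce simp: in_cells_two_partition)
      then show ?thesis
      proof cases
        case 1
        then have "m - n + 2 \<le> m - c + 1" using assms(1) by linarith
        then show ?thesis using 1 by (simp add: d1(2) lc slopes_two_partition frac_le del: of_nat_add of_nat_Suc)
      qed (simp_all add: d1(2) lc slopes_two_partition)
    qed
    also have "1 / real (m - n + 2) < w"
    proof -
      obtain l c where lc: "d\<^sub>2 = (l, c)" by fastforce
      then consider "l = 0" "c < n" "c < m" | "l = 0" "n \<le> c" "c < m" | "l = Suc 0" "c < n"
        using d2(1) assms(1) by (fastforce simp: in_cells_two_partition)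
      then show ?thesis
      proof cases
        case 1
        have "m - c + 1 < (m - n + 2) + (m - n + 2)" using assms(1) tri[OF n_pos] by linarith
        then have "real (m - c + 1) < real (m - n + 2) + real (m - n + 2)" by linarith
        then show ?thesis using 1 unfolding d2(2) lc
          by (simp add: slopes_two_partition divide_simps del: of_nat_add of_nat_Suc of_nat_diff)
      next
        case 2
        then have "m - c < m - n + 2" by linarith
        then show ?thesis using 2 unfolding d2(2) lc
          by (simp add: slopes_two_partition frac_less2 del: of_nat_add of_nat_Suc)
      next
        case 3
        then have "n - c < m - n + 2" using tri[OF n_pos] by linarith
        then show ?thesis using 3 unfolding d2(2) lc
          by (simp add: slopes_two_partition frac_less2 del: of_nat_add of_nat_Suc)
      qed
    qed
    finally show ?thesis .
  qed
  then have "M < t" "t < w" "t > 0" using \<open>M \<ge> 0\<close> by (simp_all add: t_def)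
  define F where "F = nat \<lfloor>1 / t\<rfloor>"
  have F: "1 / real x < t \<longleftrightarrow> F < x" if "x > 0" for x
  proof -
    have "1 / real x < t \<longleftrightarrow> 1 / t < real x"
      using that \<open>t > 0\<close> by (simp add: field_simps)
    also have "\<dots> \<longleftrightarrow> F < x"
      using \<open>t > 0\<close> that unfolding F_def by (simp add: nat_less_iff floor_less_iff)
    finally show ?thesis .
  qed
  \<comment> \<open>This comes from the cell \<open>(0, n)\<close> and later excludes columns from
    \<open>n\<close> on as non-similar.\<close>
  have diff: "m - n \<le> F"
  proof (cases "n < m")
    case True
    then have "w \<le> 1 / real (m - n)"
      using w[of "(0, n)"] by (simp add: in_cells_two_partition slopes_two_partition)
    then show ?thesis using F[of "m - n"] True \<open>t < w\<close> by linarith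
  qed simp
  have w_n: "w \<le> 1 / real n" "w \<le> 2 / real (m + 1)" if "0 < n"
    using w[of "(Suc 0, 0)"] w[of "(0, 0)"] that assms(1)
    by (simp_all add: in_cells_two_partition slopes_two_partition)
  show ?thesis
  proof
    show "n \<le> F" if "0 < n" using F[OF that] w_n[OF that] \<open>t < w\<close> by linarith
    show "F + n \<le> m + 1" if "0 < n"
    proof -
      have "m - (n - 1) + 1 = m - n + 2" using that assms(1) by linarith
      then have "1 / real (m - n + 2) \<le> M"
        using M[of "(0, n - 1)"] that assms(1)
        by (simp add: in_cells_two_partition slopes_two_partition del: of_nat_add of_nat_Suc of_nat_diff)
      then have "F < m - n + 2" using F[of "m - n + 2"] \<open>M < t\<close> by simp
      then show ?thesis using assms(1) by linarith
    qed
    fix a b assume ab: "b \<le> a" "a \<le> m" "b \<le> n"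
    \<comment> \<open>For a bottom cell with a cell above it, \<open>v_plus\<close> is large enough
      by comparison with \<open>(0, 0)\<close>; only \<open>v_minus\<close> decides.\<close>
    have sim0: "similar_cell ?p (two_partition a b) (0, c) \<longleftrightarrow> \<not> a < F + c" if "c < b" for c
    proof -
      have "t \<le> 2 / real (m + 1)" using w_n(2) that ab \<open>t < w\<close> by linarith
      also have "\<dots> \<le> 2 / real (a - c + 1)" using ab by (intro divide_left_mono) auto
      finally have "t \<le> v_plus (0, c) (two_partition a b)"
        using that ab by (simp add: slopes_two_partition)
      moreover have "v_minus (0, c) (two_partition a b) < t \<longleftrightarrow> F < a - c + 1"
        using that ab F[of "a - c + 1"] by (simp add: slopes_two_partition)
      ultimately show ?thesis
        using that ab by (auto simp: similar_cell_def in_cells_two_partition t_def M_def w_def)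
    qed
    \<comment> \<open>With no cell above, \<open>v_minus\<close> is 0 and only \<open>v_plus\<close>
      decides.\<close>
    have sim1: "similar_cell ?p (two_partition a b) (0, c) \<longleftrightarrow> \<not> (c < n \<and> F + c < a)"
      if "b \<le> c" "c < a" for c
    proof -
      have "t \<le> v_plus (0, c) (two_partition a b) \<longleftrightarrow> \<not> F < a - c"
        using that F[of "a - c"] by (simp add: slopes_two_partition not_less[symmetric] del: of_nat_diff)
      moreover have "v_minus (0, c) (two_partition a b) < t"
        using that \<open>t > 0\<close> by (simp add: slopes_two_partition)
      moreover have "F < a - c \<longleftrightarrow> c < n \<and> F + c < a" using diff ab by linarith
      ultimately show ?thesis
        using that by (simp add: similar_cell_def in_cells_two_partition t_def M_def w_def)
    qed
    have sim2: "similar_cell ?p (two_partition a b) (Suc 0, c)" if "c < b" for c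
    proof -
      have "t \<le> 1 / real n" using w_n(1) that ab \<open>t < w\<close> by linarith
      also have "\<dots> \<le> 1 / real (b - c)" using that ab by (intro divide_left_mono) auto
      finally show ?thesis
        using that \<open>t > 0\<close>
        by (simp add: similar_cell_def in_cells_two_partition slopes_two_partition t_def M_def w_def)
    qed
    have "{d. similar_cell ?p (two_partition a b) d} = cells (two_partition a b) -
      Pair 0 ` ({k. k < b \<and> a < F + k} \<union> {k. b \<le> k \<and> k < n \<and> F + k < a})" (is "?L = ?R")
    proof (intro set_eqI)
      fix d :: cell
      obtain l c where [simp]: "d = (l, c)" by fastforce
      consider "l = 0" "c < b" | "l = 0" "b \<le> c" "c < a" | "l = Suc 0" "c < b"
        | "d \<notin> cells (two_partition a b)"
        by (auto simp: in_cells_two_partition) linarith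
      then show "d \<in> ?L \<longleftrightarrow> d \<in> ?R"
      proof cases
        case 4
        then show ?thesis by (simp add: similar_cell_def)
      qed (use sim0[of c] sim1[of c] sim2[of c] ab in \<open>auto simp: in_cells_two_partition\<close>)
    qed
    then show "sim ?p (two_partition a b) = a + b - deficits n (\<lambda>k. F + k) a b"
      unfolding sim_def using ab by (simp add: card_cells_minus_deficit_columns)
  qed
qed

section \<open>Labels and deficit cells of a tableau\<close>

definition lower_count :: "nat \<Rightarrow> tableau \<Rightarrow> nat \<Rightarrow> nat" where
  "lower_count m \<theta> k = card {c. c < m \<and> \<theta> (0, c) < \<theta> (1, k)}"

context
  fixes m n :: nat and \<theta> :: tableau
  assumes n_le_m: "n \<le> m"
    and syt: "standard_young_tableau (two_partition m n) \<theta>"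
begin

abbreviation lower :: "nat \<Rightarrow> nat" where
  "lower \<equiv> lower_count m \<theta>"

lemma syt_bij: "bij_betw \<theta> (cells (two_partition m n)) {1..m + n}"
  using syt by (simp add: standard_young_tableau_def)

lemma syt_row: "c < c' \<Longrightarrow> (l, c') \<in> cells (two_partition m n) \<Longrightarrow> \<theta> (l, c) < \<theta> (l, c')"
  using syt unfolding standard_young_tableau_def by (auto simp: in_cells_two_partition)

lemma syt_column: "k < n \<Longrightarrow> \<theta> (0, k) < \<theta> (1, k)"
  using syt n_le_m unfolding standard_young_tableau_def
  by (auto simp: in_cells_two_partition)

lemma lower_neq_upper:
  assumes "c < m" "k < n"
  shows "\<theta> (0, c) \<noteq> \<theta> (1, k)"
proof -
  have "(0, c) \<in> cells (two_partition m n)" "(1, k) \<in> cells (two_partition m n)"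
    using assms by (simp_all add: in_cells_two_partition)
  then have "\<theta> (0, c) = \<theta> (1, k) \<longleftrightarrow> (0::nat, c) = (1, k)"
    using syt_bij by (intro inj_on_eq_iff) (simp_all add: bij_betw_def)
  then show ?thesis by simp
qed

lemma lower_less_upper_iff:
  assumes "k < n"
  shows "c < m \<and> \<theta> (0, c) < \<theta> (1, k) \<longleftrightarrow> c < lower k"
proof -
  have "{c. c < m \<and> \<theta> (0, c) < \<theta> (1, k)} = {..<lower k}"
    unfolding lower_count_def
  proof (rule finite_downset_nat_eq_lessThan)
    fix x y assume "x \<in> {c. c < m \<and> \<theta> (0, c) < \<theta> (1, k)}" "y < x"
    then show "y \<in> {c. c < m \<and> \<theta> (0, c) < \<theta> (1, k)}"
      using syt_row[of y x 0] by (simp add: in_cells_two_partition)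
  qed simp
  then have "c \<in> {c. c < m \<and> \<theta> (0, c) < \<theta> (1, k)} \<longleftrightarrow> c \<in> {..<lower k}" by simp
  then show ?thesis by simp
qed

lemma lower_count_mono:
  assumes "j \<le> k" "k < n"
  shows "lower j \<le> lower k"
proof (cases "j = k")
  case False
  then have "\<theta> (1, j) < \<theta> (1, k)" using assms syt_row[of j k 1] by (simp add: in_cells_two_partition)
  then show ?thesis unfolding lower_count_def by (intro card_mono) auto
qed simp

lemma lower_count_gt: "k < n \<Longrightarrow> k < lower k"
  using syt_column[of k] lower_less_upper_iff[of k k] n_le_m by simp

lemma lower_count_le: "k < n \<Longrightarrow> lower k \<le> m"
  using lower_less_upper_iff[of k m] by simp

text \<open>The labels up to \<open>\<theta> (1, k)\<close> occupy the first \<open>lower k\<close>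
  bottom cells and the first \<open>k + 1\<close> upper cells; counting them gives the
  label.\<close>

lemma upper_label:
  assumes "k < n"
  shows "\<theta> (1, k) = lower k + k + 1"
proof -
  let ?S = "Pair (0::nat) ` {..<lower k} \<union> Pair 1 ` {..k}"
  have S: "?S = {d \<in> cells (two_partition m n). \<theta> d \<le> \<theta> (1, k)}" (is "_ = ?T")
  proof (intro set_eqI)
    fix d :: cell
    obtain l c where [simp]: "d = (l, c)" by fastforce
    have neq: "\<theta> (0, c) \<noteq> \<theta> (1, k)" if "c < m"
      using that assms by (rule lower_neq_upper)
    have "\<theta> (1, c) \<le> \<theta> (1, k) \<longleftrightarrow> c \<le> k" if "c < n"
      using syt_row[of c k 1] syt_row[of k c 1] that assms
      by (cases c k rule: linorder_cases) (auto simp: in_cells_two_partition)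
    then show "d \<in> ?S \<longleftrightarrow> d \<in> ?T"
      using lower_less_upper_iff[OF assms, of c] neq assms
      by (auto simp: in_cells_two_partition image_iff le_less)
  qed
  have "\<theta> ` ?T = {1..\<theta> (1, k)}"
  proof -
    have img: "\<theta> ` cells (two_partition m n) = {1..m + n}" using syt_bij by (simp add: bij_betw_def)
    have "\<theta> (1, k) \<in> {1..m + n}"
      unfolding img[symmetric] using assms by (intro imageI) (simp add: in_cells_two_partition)
    moreover have "\<theta> ` ?T = {x \<in> \<theta> ` cells (two_partition m n). x \<le> \<theta> (1, k)}" by auto
    ultimately show ?thesis unfolding img by auto
  qed
  moreover have "inj_on \<theta> ?T" using syt_bij by (auto simp: bij_betw_def intro: inj_on_subset)
  ultimately have "card ?T = \<theta> (1, k)" by (metis card_image card_atLeastAtMost diff_Suc_1)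
  moreover have "card ?S = lower k + (k + 1)"
    by (subst card_Un_disjoint) (auto simp: card_image inj_on_def)
  ultimately show ?thesis unfolding S by simp
qed

text \<open>Within a row a missing cell lies to the right and has a larger label, so the two
  witnesses lie in different rows. Hence the deficit cell is in the bottom row, and its column is
  that of the upper witness.\<close>

lemma deficit_cell_two_partition_iff:
  assumes "b \<le> a" "a \<le> m" "b \<le> n"
  shows "deficit_cell (two_partition m n) \<theta> (two_partition a b) d \<longleftrightarrow>
    d \<in> Pair 0 ` ({k. k < b \<and> a < lower k} \<union> {k. b \<le> k \<and> k < n \<and> lower k < a})"
proof
  assume "deficit_cell (two_partition m n) \<theta> (two_partition a b) d"
  then obtain i\<^sub>1 j\<^sub>1 i\<^sub>2 j\<^sub>2 where *: "(i\<^sub>1, j\<^sub>1) \<in> cells (two_partition a b)"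
    "(i\<^sub>2, j\<^sub>2) \<in> cells (two_partition m n)" "(i\<^sub>2, j\<^sub>2) \<notin> cells (two_partition a b)"
    "\<theta> (i\<^sub>2, j\<^sub>2) < \<theta> (i\<^sub>1, j\<^sub>1)" "d = (min i\<^sub>1 i\<^sub>2, min j\<^sub>1 j\<^sub>2)"
    unfolding deficit_cell_def by blast
  have "i\<^sub>1 \<noteq> i\<^sub>2"
    using * syt_row[of j\<^sub>1 j\<^sub>2 i\<^sub>1] by (auto simp: in_cells_two_partition)
  then consider "i\<^sub>1 = 1" "i\<^sub>2 = 0" | "i\<^sub>1 = 0" "i\<^sub>2 = 1"
    using *(1,2) by (auto simp: in_cells_two_partition)
  then show "d \<in> Pair 0 ` ({k. k < b \<and> a < lower k} \<union> {k. b \<le> k \<and> k < n \<and> lower k < a})"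
  proof cases
    case 1
    then have j: "j\<^sub>1 < b" "a \<le> j\<^sub>2" "j\<^sub>2 < m" using * by (auto simp: in_cells_two_partition)
    then have "j\<^sub>2 < lower j\<^sub>1"
      using lower_less_upper_iff[of j\<^sub>1 j\<^sub>2] * 1 assms by simp
    then show ?thesis using j 1 *(5) assms by auto
  next
    case 2
    then have j: "j\<^sub>1 < a" "b \<le> j\<^sub>2" "j\<^sub>2 < n" using * by (auto simp: in_cells_two_partition)
    then have "lower j\<^sub>2 \<le> j\<^sub>1"
      using lower_less_upper_iff[of j\<^sub>2 j\<^sub>1] * 2 assms by simp
    then show ?thesis using j 2 *(5) lower_count_gt[of j\<^sub>2] by auto
  qed
next
  assume "d \<in> Pair 0 ` ({k. k < b \<and> a < lower k} \<union> {k. b \<le> k \<and> k < n \<and> lower k < a})"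
  then obtain k where k: "d = (0, k)" "k < b \<and> a < lower k \<or> b \<le> k \<and> k < n \<and> lower k < a" by blast
  from k(2) show "deficit_cell (two_partition m n) \<theta> (two_partition a b) d"
  proof
    assume "k < b \<and> a < lower k"
    then have "(1, k) \<in> cells (two_partition a b)"
      "(0, a) \<in> cells (two_partition m n) - cells (two_partition a b)" "\<theta> (0, a) < \<theta> (1, k)"
      using lower_less_upper_iff[of k a] lower_count_le[of k] assms
      by (auto simp: in_cells_two_partition)
    moreover have "d = (min 1 0, min k a)" using k(1) \<open>k < b \<and> a < lower k\<close> assms by simp
    ultimately show ?thesis unfolding deficit_cell_def by blast
  next
    assume k': "b \<le> k \<and> k < n \<and> lower k < a"
    \<comment> \<open>Column \<open>lower k\<close> holds the first lower label above the
      \<open>k\<close>-th upper one.\<close>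
    then have cells: "(0, lower k) \<in> cells (two_partition a b)"
      "(1, k) \<in> cells (two_partition m n) - cells (two_partition a b)"
      by (auto simp: in_cells_two_partition)
    have "\<theta> (1, k) \<le> \<theta> (0, lower k)" using lower_less_upper_iff[of k "lower k"] k' assms by simp
    moreover have "\<theta> (1, k) \<noteq> \<theta> (0, lower k)"
      using lower_neq_upper[of "lower k" k] k' assms by simp
    ultimately have "\<theta> (1, k) < \<theta> (0, lower k)" by simp
    moreover have "d = (min 0 1, min (lower k) k)" using k(1) lower_count_gt[of k] k' by simp
    ultimately show ?thesis using cells unfolding deficit_cell_def by blast
  qed
qed

lemma sim_tableau_two_partition:
  assumes "b \<le> a" "a \<le> m" "b \<le> n"
  shows "sim_tableau (two_partition m n) \<theta> (two_partition a b) = a + b - deficits n lower a b"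
proof -
  have "{d \<in> cells (two_partition a b). \<not> deficit_cell (two_partition m n) \<theta> (two_partition a b) d} =
    cells (two_partition a b) -
      Pair 0 ` ({k. k < b \<and> a < lower k} \<union> {k. b \<le> k \<and> k < n \<and> lower k < a})"
    using deficit_cell_two_partition_iff[OF assms] by blast
  moreover have "k \<le> lower k" if "k < n" for k using lower_count_gt[OF that] by simp
  ultimately show ?thesis
    unfolding sim_tableau_def
    using card_cells_minus_deficit_columns[of n lower b a] assms by simp
qed

section \<open>Row-regular and sim-sym tableaux through lower counts\<close>

text \<open>By \<open>upper_label\<close> the start is \<open>s = n + i - 1\<close>, and the range
  of \<open>i\<close> turns into the two bounds on \<open>s\<close>.\<close>

lemma row_regular_iff:
  "row_regular m n \<theta> \<longleftrightarrow> (\<exists>s. n \<le> s \<and> s + n \<le> m + 1 \<and> (\<forall>k<n. lower k = s + k))"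
proof -
  have reg: "i_row_regular i m n \<theta> \<longleftrightarrow> (\<forall>k<n. lower k + 1 = n + i + k)" for i
    using syt upper_label by (auto simp: i_row_regular_def upper_row_def list_eq_iff_nth_eq)
  show ?thesis
  proof
    assume "row_regular m n \<theta>"
    then obtain i where "1 \<le> i" "int i \<le> int m - 2 * (int n - 1)" "\<forall>k<n. lower k + 1 = n + i + k"
      unfolding row_regular_def reg by blast
    then show "\<exists>s. n \<le> s \<and> s + n \<le> m + 1 \<and> (\<forall>k<n. lower k = s + k)"
      by (intro exI[of _ "n + i - 1"]) auto
  next
    assume "\<exists>s. n \<le> s \<and> s + n \<le> m + 1 \<and> (\<forall>k<n. lower k = s + k)"
    then obtain s where "n \<le> s" "s + n \<le> m + 1" "\<forall>k<n. lower k = s + k" by blast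
    then show "row_regular m n \<theta>"
      unfolding row_regular_def reg by (intro exI[of _ "s + 1 - n"]) auto
  qed
qed

lemma upper_row_2_5_iff:
  assumes "n = 2"
  shows "upper_row n \<theta> = [2, 5] \<longleftrightarrow> lower 0 = 1 \<and> lower 1 = 3"
  using upper_label[of 0] upper_label[of 1] assms by (auto simp: upper_row_def upt_rec)

text \<open>The similar cells give the consecutive sequence starting at \<open>F\<close>, which is
  balanced, so equality of the polynomials means balance of the tableau's own sequence.\<close>

lemma sim_sym_iff_balanced:
  assumes "0 < n \<Longrightarrow> 2 * n \<le> m + 1"
  shows "sim_sym (two_partition m n) \<theta> \<longleftrightarrow> balanced m n (deficits n lower)"
proof -
  obtain F where F: "0 < n \<Longrightarrow> n \<le> F" "0 < n \<Longrightarrow> F + n \<le> m + 1"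
    and sim: "\<And>a b. b \<le> a \<Longrightarrow> a \<le> m \<Longrightarrow> b \<le> n \<Longrightarrow>
       sim (two_partition m n) (two_partition a b) = a + b - deficits n (\<lambda>k. F + k) a b"
    using sim_two_partition[OF n_le_m assms] by blast
  have "balanced m n (deficits n (\<lambda>k. F + k))"
  proof (cases "n = 0")
    case True
    then show ?thesis by (intro balanced_consecutive[of n 0]) auto
  next
    case False
    then show ?thesis using F by (intro balanced_consecutive[of n F]) auto
  qed
  moreover have "deficits n (\<lambda>k. F + k) a b \<le> a + b" if "(a, b) \<in> pairs m n" for a b
  proof -
    have "k \<le> F + k" if "k < n" for k
      using F that by simp
    then show ?thesis
      using deficits_le[of n "\<lambda>k. F + k" b a] that by (simp add: pairs_def)
  qed
  moreover have "deficits n lower a b \<le> a + b" if "(a, b) \<in> pairs m n" for a b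
  proof -
    have "k \<le> lower k" if "k < n" for k using lower_count_gt[OF that] by simp
    then show ?thesis using deficits_le[of n lower b a] that by (simp add: pairs_def)
  qed
  ultimately have "(\<Sum>(a, b)\<in>pairs m n. qt_monom (m + n - (a + b)) (a + b - deficits n lower a b)) =
      (\<Sum>(a, b)\<in>pairs m n. qt_monom (m + n - (a + b)) (a + b - deficits n (\<lambda>k. F + k) a b)) \<longleftrightarrow>
      balanced m n (deficits n lower)"
    by (intro sum_pairs_eq_iff_balanced[OF n_le_m])
  then show ?thesis
    unfolding sim_sym_def A_tableau_def A_partition_def
    using sum_subpartitions_two_partition[of m n "sim_tableau (two_partition m n) \<theta>" "deficits n lower"]
      sum_subpartitions_two_partition[of m n "sim (two_partition m n)" "deficits n (\<lambda>k. F + k)"]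
      sim_tableau_two_partition sim by simp
qed

lemma balanced_iff:
  assumes "0 < n \<Longrightarrow> 2 * n \<le> m + 1"
  shows "balanced m n (deficits n lower) \<longleftrightarrow>
    (\<exists>s. n \<le> s \<and> s + n \<le> m + 1 \<and> (\<forall>k<n. lower k = s + k)) \<or> n = 2 \<and> lower 0 = 1 \<and> lower 1 = 3"
    (is "?B \<longleftrightarrow> ?R")
proof
  assume ?B
  \<comment> \<open>With fewer than two values the sequence is trivially consecutive; for
    \<open>n = 1\<close> the start is its only value.\<close>
  consider "n = 0" | "n = 1" | "2 \<le> n" by linarith
  then show ?R
  proof cases
    case 1
    then show ?thesis by auto
  next
    case 2
    then show ?thesis
      using lower_count_gt[of 0] lower_count_le[of 0] by (intro disjI1 exI[of _ "lower 0"]) auto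
  next
    case 3
    show ?thesis
      by (rule balanced_imp[OF \<open>?B\<close> 3])
        (use 3 assms lower_count_mono lower_count_gt lower_count_le in auto)
  qed
next
  assume ?R
  then show ?B
    using balanced_consecutive[of n _ m lower] balanced_exceptional[of m lower] assms by auto
qed

end

theorem theorem4p16:
  fixes m n :: nat and \<theta> :: tableau
  assumes "n \<le> m"
    and "triangular (two_partition m n)"
    and "standard_young_tableau (two_partition m n) \<theta>"
  shows "(n \<noteq> 2 \<longrightarrow> (sim_sym (two_partition m n) \<theta> \<longleftrightarrow> row_regular m n \<theta>)) \<and>
         (n = 2 \<longrightarrow> (sim_sym (two_partition m n) \<theta> \<longleftrightarrow>
                      row_regular m n \<theta> \<or> upper_row n \<theta> = [2, 5]))"
proof -
  have tri: "0 < n \<Longrightarrow> 2 * n \<le> m + 1"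
    using assms(2) by (rule triangular_two_partition)
  have "sim_sym (two_partition m n) \<theta> \<longleftrightarrow> row_regular m n \<theta> \<or>
      n = 2 \<and> lower_count m \<theta> 0 = 1 \<and> lower_count m \<theta> 1 = 3"
    using sim_sym_iff_balanced[OF assms(1,3) tri] balanced_iff[OF assms(1,3) tri]
      row_regular_iff[OF assms(1,3)] by simp
  then show ?thesis
    using upper_row_2_5_iff[OF assms(1,3)] by auto
qed

end
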